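(* For each integer $a\ge 0$, there exists an integer $t_2=t_2(a)$ such that for every integer $t\ge t_2$, there exists a $K_t$-minor-free graph that is not $\{1\star (t-5a-9),\,3\star (2a+3)\}$-choosable.
   Context: All graphs are finite and simple. A graph is $K_t$-minor-free if $K_t$ cannot be obtained from a subgraph of it by contracting edges. A list assignment $L$ of a graph $G$ assigns to each vertex $v$ a set $L(v)$ of colours; an $L$-colouring is a proper colouring $f$ with $f(v)\in L(v)$ for all $v$. For a multiset $\lambda=\{k_1,\dots,k_q\}$ of positive integers, a $\lambda$-list assignment of $G$ is a list assignment $L$ such that the colour set $\bigcup_{v\in V(G)}L(v)$ can be partitioned into $q$ sets $C_1,\dots,C_q$ with $|L(v)\cap C_i|\ge k_i$ for every $i$ and every vertex $v$. $G$ is $\lambda$-choosable if $G$ is $L$-colourable for every $\lambda$-list assignment $L$. The notation $b\star m$ inside a multiset means $m$ copies of $b$; so $\{1\star(t-5a-9),3\star(2a+3)\}$ consists of $t-5a-9$ ones and $2a+3$ threes. *)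

theory Defs
  imports Main
begin

definition graph :: "nat set \<Rightarrow> (nat \<Rightarrow> nat \<Rightarrow> bool) \<Rightarrow> bool" where
  "graph V E \<longleftrightarrow> finite V \<and> (\<forall>u v. E u v \<longrightarrow> u \<in> V \<and> v \<in> V)
     \<and> (\<forall>u v. E u v \<longrightarrow> E v u) \<and> (\<forall>v. \<not> E v v)"

definition connected_set :: "(nat \<Rightarrow> nat \<Rightarrow> bool) \<Rightarrow> nat set \<Rightarrow> bool" where
  "connected_set E B \<longleftrightarrow> B \<noteq> {} \<and>
     (\<forall>u\<in>B. \<forall>v\<in>B. (\<lambda>x y. E x y \<and> x \<in> B \<and> y \<in> B)\<^sup>*\<^sup>* u v)"

definition has_K_minor :: "nat set \<Rightarrow> (nat \<Rightarrow> nat \<Rightarrow> bool) \<Rightarrow> nat \<Rightarrow> bool" where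
  "has_K_minor V E t \<longleftrightarrow> (\<exists>B :: nat \<Rightarrow> nat set.
     (\<forall>i<t. B i \<subseteq> V \<and> connected_set E (B i)) \<and>
     (\<forall>i<t. \<forall>j<t. i \<noteq> j \<longrightarrow> B i \<inter> B j = {} \<and> (\<exists>u\<in>B i. \<exists>v\<in>B j. E u v)))"

definition L_colouring :: "nat set \<Rightarrow> (nat \<Rightarrow> nat \<Rightarrow> bool) \<Rightarrow> (nat \<Rightarrow> nat set) \<Rightarrow> (nat \<Rightarrow> nat) \<Rightarrow> bool" where
  "L_colouring V E L f \<longleftrightarrow> (\<forall>v\<in>V. f v \<in> L v) \<and> (\<forall>u v. E u v \<longrightarrow> f u \<noteq> f v)"

text \<open>lambda-list assignment, where lambda = {k_1,...,k_q} is given as the list ks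
(order irrelevant). Lists are finite sets of colours (colours are naturals).\<close>
definition lambda_list_assignment :: "nat set \<Rightarrow> (nat \<Rightarrow> nat set) \<Rightarrow> nat list \<Rightarrow> bool" where
  "lambda_list_assignment V L ks \<longleftrightarrow> (\<forall>v\<in>V. finite (L v)) \<and>
     (\<exists>C :: nat \<Rightarrow> nat set.
        (\<forall>i<length ks. \<forall>j<length ks. i \<noteq> j \<longrightarrow> C i \<inter> C j = {}) \<and>
        (\<Union>i<length ks. C i) = (\<Union>v\<in>V. L v) \<and>
        (\<forall>v\<in>V. \<forall>i<length ks. ks ! i \<le> card (L v \<inter> C i)))"

definition lambda_choosable :: "nat set \<Rightarrow> (nat \<Rightarrow> nat \<Rightarrow> bool) \<Rightarrow> nat list \<Rightarrow> bool" where
  "lambda_choosable V E ks \<longleftrightarrow>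
     (\<forall>L. lambda_list_assignment V L ks \<longrightarrow> (\<exists>f. L_colouring V E L f))"

end

theory Submission
  imports Defs "HOL-Library.FuncSet"
begin

text \<open>
  Start from a clique \<open>A\<close> on \<open>t - 1\<close> vertices whose lists all equal the same \<open>t + a\<close> colours. A colouring
  of \<open>A\<close> misses only \<open>a + 1\<close> of them, so at least \<open>u = a + 2\<close> of the \<open>2a + 3\<close> colour triples
  occur completely on \<open>A\<close>. For every possible position in \<open>A\<close> of \<open>u\<close> such triples, attach a clique \<open>B\<close> on
  \<open>b = t - u - 1\<close> vertices. A vertex of \<open>B\<close> is adjacent to two vertices of each of the
  \<open>u\<close> triples (which two is its type); its list drops the colour of the third one
  and receives a fourth colour of the class instead. Then only \<open>b - 1\<close> colours remain for \<open>B\<close>.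

  Every type is used by at least \<open>2u\<close> vertices of \<open>B\<close>, which requires \<open>t\<close> to be large. In a \<open>K\<^sub>t\<close>-minor
  some branch set avoids \<open>A\<close>, hence lies in one \<open>B\<close>, so all branch sets meet \<open>B\<close> or its \<open>3u\<close>
  attachment vertices. More than \<open>u\<close> branch sets miss \<open>B\<close>, and one of these contains at most one vertex of each
  triple; the vertices of some type are not adjacent to it. No branch set consists of vertices of
  this type only, so all \<open>t\<close> branch sets meet a set of at most \<open>b - 2u + 3u < t\<close> vertices.
\<close>

section \<open>Connected sets, disjoint families, list assignments and labellings\<close>

lemma connected_set_subset_if_avoids_boundary:
  assumes conn: "connected_set E X" and meets: "X \<inter> P \<noteq> {}" and avoids: "X \<inter> N = {}"
    and boundary: "\<And>x y. x \<in> P \<Longrightarrow> E x y \<Longrightarrow> y \<in> P \<union> N"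
  shows "X \<subseteq> P"
proof
  fix y assume "y \<in> X"
  obtain x where x: "x \<in> X" "x \<in> P" using meets by blast
  \<comment> \<open>A walk inside \<open>X\<close> starting in \<open>P\<close> stays there: its
    first vertex outside \<open>P\<close> would lie in \<open>N\<close>.\<close>
  have "(\<lambda>x y. E x y \<and> x \<in> X \<and> y \<in> X)\<^sup>*\<^sup>* x y"
    using conn x \<open>y \<in> X\<close> unfolding connected_set_def by blast
  then show "y \<in> P"
    by (induction rule: rtranclp_induct) (use x boundary avoids in blast)+
qed

lemma card_disjoint_family_le:
  assumes "finite I" "finite U"
    and disj: "\<And>i j. i \<in> I \<Longrightarrow> j \<in> I \<Longrightarrow> i \<noteq> j \<Longrightarrow> X i \<inter> X j = {}"
    and meets: "\<And>i. i \<in> I \<Longrightarrow> X i \<inter> U \<noteq> {}"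
  shows "card I \<le> card U"
proof -
  have "\<forall>i\<in>I. \<exists>x. x \<in> X i \<inter> U" using meets by blast
  then have "\<exists>g. \<forall>i\<in>I. g i \<in> X i \<inter> U" by (rule bchoice)
  then obtain g where g: "\<forall>i\<in>I. g i \<in> X i \<inter> U" by (elim exE)
  have "inj_on g I"
  proof (rule inj_onI, rule ccontr)
    fix i j assume "i \<in> I" "j \<in> I" "g i = g j" "i \<noteq> j"
    moreover from this have "g i \<in> X i \<inter> X j" using g by fastforce
    ultimately show False using disj by simp
  qed
  then show ?thesis using card_inj_on_le[of g I U] g assms(2) by blast
qed

text \<open>The definition demands that the classes cover exactly the colours in use. Cutting each
  \<open>C i\<close> down to these colours achieves this and leaves every
  \<open>L v \<inter> C i\<close> unchanged.\<close>

lemma lambda_list_assignmentI: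
  assumes "\<And>v. v \<in> V \<Longrightarrow> finite (L v)"
    and "\<And>i j. i < length ks \<Longrightarrow> j < length ks \<Longrightarrow> i \<noteq> j \<Longrightarrow> C i \<inter> C j = {}"
    and "(\<Union>v\<in>V. L v) \<subseteq> (\<Union>i<length ks. C i)"
    and "\<And>v i. v \<in> V \<Longrightarrow> i < length ks \<Longrightarrow> ks ! i \<le> card (L v \<inter> C i)"
  shows "lambda_list_assignment V L ks"
proof -
  define D where "D i = C i \<inter> (\<Union>v\<in>V. L v)" for i
  have "L v \<inter> D i = L v \<inter> C i" if "v \<in> V" for v i
    using that by (auto simp: D_def)
  moreover have "(\<Union>i<length ks. D i) = (\<Union>v\<in>V. L v)"
    using assms(3) by (auto simp: D_def)
  moreover have "D i \<inter> D j = {}" if "i < length ks" "j < length ks" "i \<noteq> j" for i j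
    using assms(2)[OF that] by (auto simp: D_def)
  ultimately show ?thesis
    unfolding lambda_list_assignment_def using assms(1,4) by (intro conjI exI[of _ D]) auto
qed

text \<open>Labels are dealt out cyclically, so the label with index \<open>r\<close> occurs at
  \<open>r\<close>, \<open>c + r\<close>, \<open>2 * c + r\<close> and so on, at least
  \<open>m\<close> times below \<open>m * c\<close>.\<close>

lemma ex_labelling_large_fibres:
  assumes "finite T" "T \<noteq> {}" "m * card T \<le> n"
  shows "\<exists>f :: nat \<Rightarrow> 'a. \<forall>x\<in>T. m \<le> card {l\<in>{..<n}. f l = x}"
proof -
  define c where "c = card T"
  have c: "c > 0" using assms by (simp add: c_def card_gt_0_iff)
  obtain e where e: "bij_betw e {0..<c} T"
    using ex_bij_betw_nat_finite[OF assms(1)] c_def by blast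
  have "m \<le> card {l\<in>{..<n}. e (l mod c) = x}" if "x \<in> T" for x
  proof -
    obtain r where r: "r < c" "e r = x"
      using e \<open>x \<in> T\<close> unfolding bij_betw_def by force
    have inj: "inj_on (\<lambda>q. q * c + r) {..<m}" using c by (auto simp: inj_on_def)
    have "(\<lambda>q. q * c + r) ` {..<m} \<subseteq> {l\<in>{..<n}. e (l mod c) = x}"
    proof (clarsimp simp: r)
      fix q assume "q < m"
      then have "Suc q * c \<le> m * c" by (intro mult_right_mono) auto
      then show "q * c + r < n" using r assms(3) by (simp add: c_def)
    qed
    then show ?thesis using card_inj_on_le[OF inj] by simp
  qed
  then show ?thesis by (intro exI[of _ "\<lambda>l. e (l mod c)"]) blast
qed

section \<open>The glued graph\<close>

text \<open>
  Copy \<open>k\<close> of \<open>B\<close> is attached at the vertices \<open>h k (j, i)\<close> with \<open>j \<in> J k\<close> and \<open>i < 3\<close>, which are meant to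
  have the \<open>i\<close>-th colour of the \<open>j\<close>-th triple; its vertex number \<open>l\<close> skips \<open>h k (j, ty l j)\<close>.
\<close>

locale triple_gluing =
  fixes b K u p :: nat and J :: "nat \<Rightarrow> nat set" and h :: "nat \<Rightarrow> nat \<times> nat \<Rightarrow> nat"
    and ty :: "nat \<Rightarrow> nat \<Rightarrow> nat"
  assumes J_subset: "k < K \<Longrightarrow> J k \<subseteq> {..<p}"
    and card_J: "k < K \<Longrightarrow> card (J k) = u"
    and h_range: "k < K \<Longrightarrow> h k ` (J k \<times> {..<3}) \<subseteq> {..<b + u}"
    and fibre: "\<tau> \<in> {..<p} \<rightarrow>\<^sub>E {..<3} \<Longrightarrow> 2 * u \<le> card {l\<in>{..<b}. \<forall>j<p. ty l j = \<tau> j}"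
begin

text \<open>The clique \<open>A\<close> is the initial segment \<open>{..<b + u}\<close>; the copies
  follow as blocks of length \<open>b\<close>, so \<open>div\<close> and \<open>mod\<close> recover
  \<open>k\<close> and \<open>l\<close>.\<close>

definition vx :: "nat \<Rightarrow> nat \<Rightarrow> nat" where
  "vx k l = b + u + k * b + l"

definition nb :: "nat \<Rightarrow> nat \<Rightarrow> nat set" where
  "nb k l = h k ` {(j, i). j \<in> J k \<and> i < 3 \<and> i \<noteq> ty l j}"

definition V :: "nat set" where
  "V = {..<b + u} \<union> {vx k l | k l. k < K \<and> l < b}"

definition E :: "nat \<Rightarrow> nat \<Rightarrow> bool" where
  "E x y \<longleftrightarrow> x < b + u \<and> y < b + u \<and> x \<noteq> y
     \<or> (\<exists>k<K. \<exists>l<b. \<exists>l'<b. l \<noteq> l' \<and> x = vx k l \<and> y = vx k l')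
     \<or> (\<exists>k<K. \<exists>l<b. x = vx k l \<and> y \<in> nb k l \<or> y = vx k l \<and> x \<in> nb k l)"

lemma vx_eq_iff: "l < b \<Longrightarrow> l' < b \<Longrightarrow> vx k l = vx k' l' \<longleftrightarrow> k = k' \<and> l = l'"
proof
  assume *: "l < b" "l' < b" "vx k l = vx k' l'"
  then have "(k * b + l) div b = (k' * b + l') div b" "(k * b + l) mod b = (k' * b + l') mod b"
    by (simp_all add: vx_def)
  then show "k = k' \<and> l = l'" using * by simp
qed simp

lemma vx_ge: "\<not> vx k l < b + u"
  by (simp add: vx_def)

lemma nb_subset: "nb k l \<subseteq> h k ` (J k \<times> {..<3})"
  by (auto simp: nb_def)

lemma nb_less: "k < K \<Longrightarrow> x \<in> nb k l \<Longrightarrow> x < b + u"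
  using nb_subset h_range by blast

lemma vx_notin_nb: "k < K \<Longrightarrow> vx k' l' \<notin> nb k l"
  using nb_less vx_ge by blast

lemma graph_V_E: "graph V E"
  unfolding graph_def
proof (intro conjI allI impI)
  have "{vx k l | k l. k < K \<and> l < b} = (\<lambda>(k, l). vx k l) ` ({..<K} \<times> {..<b})" by auto
  then show "finite V" by (simp add: V_def)
  show "\<not> E v v" for v
    by (auto simp: E_def vx_eq_iff vx_notin_nb)
  fix x y assume "E x y"
  then show "x \<in> V" "y \<in> V"
    using nb_less by (auto simp: E_def V_def)
  show "E y x"
    using \<open>E x y\<close> unfolding E_def by (elim disjE) blast+
qed

lemma E_vx_cases:
  assumes "k < K" "l < b" "E (vx k l) y"
  obtains l' where "l' < b" "l' \<noteq> l" "y = vx k l'" | "y \<in> nb k l"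
  using assms by (auto simp: E_def vx_eq_iff vx_ge vx_notin_nb)

section \<open>Excluding the clique minor\<close>

lemma no_K_minor: "\<not> has_K_minor V E (b + u + 1)"
proof
  assume "has_K_minor V E (b + u + 1)"
  then obtain X where X': "\<forall>i<b + u + 1. X i \<subseteq> V \<and> connected_set E (X i)"
    "\<forall>i<b + u + 1. \<forall>j<b + u + 1. i \<noteq> j \<longrightarrow>
       X i \<inter> X j = {} \<and> (\<exists>x\<in>X i. \<exists>y\<in>X j. E x y)"
    unfolding has_K_minor_def by (elim exE conjE)
  have X: "X i \<subseteq> V" "connected_set E (X i)" if "i < b + u + 1" for i
    using X'(1) that by simp_all
  have XX: "X i \<inter> X j = {}" "\<exists>x\<in>X i. \<exists>y\<in>X j. E x y"
    if "i < b + u + 1" "j < b + u + 1" "i \<noteq> j" for i j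
    using X'(2) that by simp_all
  have few: "\<exists>i<b + u + 1. X i \<inter> U = {}" if "finite U" "card U < b + u + 1" for U
  proof (rule ccontr)
    assume "\<not> ?thesis"
    then have "card {..<b + u + 1} \<le> card U"
      by (intro card_disjoint_family_le[of _ _ X]) (use that XX(1) in auto)
    then show False using that(2) by simp
  qed
  obtain i0 where i0: "i0 < b + u + 1" "X i0 \<inter> {..<b + u} = {}"
    using few[of "{..<b + u}"] by auto
  obtain x0 where "x0 \<in> X i0"
    using X[OF i0(1)] by (auto simp: connected_set_def)
  then obtain k l0 where k: "k < K" "l0 < b" "vx k l0 \<in> X i0"
    using X[OF i0(1)] i0(2) by (auto simp: V_def)
  define B S where "B = vx k ` {..<b}" and "S = h k ` (J k \<times> {..<3})"
  have nbS: "nb k l \<subseteq> S" for l using nb_subset by (simp add: S_def)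
  have S: "S \<subseteq> {..<b + u}" using h_range[OF k(1)] by (simp add: S_def)
  have finJ: "finite (J k)" using J_subset[OF k(1)] finite_subset by blast
  have card_B: "card B \<le> b" and fin: "finite B" "finite S"
    using card_image_le[of "{..<b}" "vx k"] finJ by (auto simp: B_def S_def)
  have card_S: "card S \<le> 3 * u"
    using card_image_le[of "J k \<times> {..<3}" "h k"] finJ card_J[OF k(1)] by (simp add: S_def)
  have B_nbrs: "y \<in> B \<union> S" if "x \<in> B" "E x y" for x y
    using that nbS k(1) by (auto simp: B_def elim!: E_vx_cases)
  have i0B: "X i0 \<subseteq> B"
    by (rule connected_set_subset_if_avoids_boundary[of E _ B S])
      (use X(2)[OF i0(1)] k i0(2) S B_nbrs in \<open>auto simp: B_def\<close>)
  have meets: "X i \<inter> (B \<union> S) \<noteq> {}" if "i < b + u + 1" for i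
  proof (cases "i = i0")
    case True
    then show ?thesis using i0B k(3) by blast
  next
    case False
    then show ?thesis using XX(2)[OF i0(1) that] i0B B_nbrs by blast
  qed
  define I where "I = {i. i < b + u + 1 \<and> X i \<inter> B = {}}"
  \<comment> \<open>At most \<open>b\<close> of the \<open>b + u + 1\<close> disjoint branch sets
    can meet \<open>B\<close>.\<close>
  have "card ({..<b + u + 1} - I) \<le> card B"
    by (rule card_disjoint_family_le[of _ _ X]) (use XX(1) fin in \<open>auto simp: I_def\<close>)
  moreover have "card ({..<b + u + 1} - I) = b + u + 1 - card I"
    by (subst card_Diff_subset) (auto simp: I_def)
  ultimately have card_I: "u < card I" using card_B by linarith
  define fat where "fat i j \<longleftrightarrow> 2 \<le> card {c\<in>{..<3}. h k (j, c) \<in> X i}" for i j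
  \<comment> \<open>Two disjoint branch sets cannot both contain two vertices of the same triple.\<close>
  have "\<exists>i\<in>I. \<forall>j\<in>J k. \<not> fat i j"
  proof (rule ccontr)
    assume "\<not> ?thesis"
    then have "\<forall>i\<in>I. \<exists>j. j \<in> J k \<and> fat i j" by blast
    then have "\<exists>g. \<forall>i\<in>I. g i \<in> J k \<and> fat i (g i)" by (rule bchoice)
    then obtain g where g: "\<forall>i\<in>I. g i \<in> J k \<and> fat i (g i)" by (elim exE)
    have "inj_on g I"
    proof (rule inj_onI, rule ccontr)
      fix i i' assume *: "i \<in> I" "i' \<in> I" "g i = g i'" "i \<noteq> i'"
      let ?T = "\<lambda>i. {c\<in>{..<3}. h k (g i', c) \<in> X i}"
      have "X i \<inter> X i' = {}" using * XX(1) by (auto simp: I_def)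
      then have "card (?T i \<union> ?T i') = card (?T i) + card (?T i')"
        by (intro card_Un_disjoint) auto
      moreover have "card (?T i \<union> ?T i') \<le> card {..<3::nat}"
        by (intro card_mono) auto
      moreover have "2 \<le> card (?T i)" "2 \<le> card (?T i')" using g *(1,2) *(3)[symmetric] by (auto simp: fat_def)
      ultimately show False by simp
    qed
    then have "card I \<le> card (J k)" using g finJ by (intro card_inj_on_le[of g]) auto
    then show False using card_I card_J[OF k(1)] by simp
  qed
  then obtain i where i: "i \<in> I" and thin: "\<And>j. j \<in> J k \<Longrightarrow> \<not> fat i j" by blast
  have ex_d: "\<exists>d<3. \<forall>c<3. h k (j, c) \<in> X i \<longrightarrow> c = d" if "j \<in> J k" for j
  proof (cases "\<exists>d<3. h k (j, d) \<in> X i")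
    case True
    then obtain d where d: "d < 3" "h k (j, d) \<in> X i" by blast
    have "c = d" if "c < 3" "h k (j, c) \<in> X i" for c
    proof (rule ccontr)
      assume "c \<noteq> d"
      then have "card {c, d} \<le> card {c\<in>{..<3}. h k (j, c) \<in> X i}"
        using d that by (intro card_mono) auto
      then show False using thin[OF \<open>j \<in> J k\<close>] \<open>c \<noteq> d\<close> by (simp add: fat_def)
    qed
    then show ?thesis using d by blast
  next
    case False
    then show ?thesis by (intro exI[of _ 0]) auto
  qed
  have "\<exists>\<sigma>. \<forall>j\<in>J k. \<sigma> j < 3 \<and> (\<forall>c<3. h k (j, c) \<in> X i \<longrightarrow> c = \<sigma> j)"
    by (rule bchoice) (use ex_d in blast)
  then obtain \<sigma> where "\<forall>j\<in>J k. \<sigma> j < 3 \<and> (\<forall>c<3. h k (j, c) \<in> X i \<longrightarrow> c = \<sigma> j)"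
    by (elim exE)
  then have \<sigma>: "\<sigma> j < 3" "c < 3 \<Longrightarrow> h k (j, c) \<in> X i \<Longrightarrow> c = \<sigma> j" if "j \<in> J k" for j c
    using that by blast+
  \<comment> \<open>Vertices of type \<open>\<tau>\<close> skip, in every triple of
    \<open>J k\<close>, the only vertex that \<open>X i\<close> may contain, so \<open>X i\<close>
    has no neighbour among them. Outside \<open>J k\<close> the value 0 is arbitrary padding, since
    a type is a function on all of \<open>{..<p}\<close>.\<close>
  define \<tau> where "\<tau> = (\<lambda>j\<in>{..<p}. if j \<in> J k then \<sigma> j else 0)"
  define Q where "Q = {l\<in>{..<b}. \<forall>j<p. ty l j = \<tau> j}"
  define P where "P = vx k ` Q"
  have "\<tau> \<in> {..<p} \<rightarrow>\<^sub>E {..<3}" using \<sigma>(1) by (auto simp: \<tau>_def)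
  then have "2 * u \<le> card Q" unfolding Q_def by (rule fibre)
  moreover have "card P = card Q"
    unfolding P_def by (intro card_image) (auto simp: inj_on_def Q_def vx_eq_iff)
  moreover have PB: "P \<subseteq> B" by (auto simp: P_def B_def Q_def)
  moreover have "card (B - P) = card B - card P"
    using fin(1) PB by (intro card_Diff_subset) (auto intro: finite_subset)
  moreover have "card P \<le> card B" using card_mono[OF fin(1) PB] .
  moreover have "card ((B - P) \<union> S) \<le> card (B - P) + card S" by (rule card_Un_le)
  ultimately have "card ((B - P) \<union> S) < b + u + 1" using card_B card_S by linarith
  then obtain i' where i': "i' < b + u + 1" "X i' \<inter> ((B - P) \<union> S) = {}"
    using few[of "(B - P) \<union> S"] fin by blast
  \<comment> \<open>\<open>X i'\<close> meets \<open>B \<union> S\<close> but avoids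
    \<open>(B - P) \<union> S\<close>, so it meets \<open>P\<close>; all neighbours of
    \<open>P\<close> lie in \<open>B \<union> S\<close>.\<close>
  have "X i' \<subseteq> P"
    by (rule connected_set_subset_if_avoids_boundary[of E _ P "(B - P) \<union> S"])
      (use X(2)[OF i'(1)] i' meets[OF i'(1)] PB B_nbrs in auto)
  have "i < b + u + 1" "X i \<inter> B = {}" using i by (auto simp: I_def)
  moreover have "X i' \<noteq> {}" using X[OF i'(1)] by (auto simp: connected_set_def)
  ultimately have "i' \<noteq> i" using \<open>X i' \<subseteq> P\<close> PB by blast
  then obtain x y where xy: "x \<in> X i'" "y \<in> X i" "E x y"
    using XX(2) i'(1) \<open>i < b + u + 1\<close> by blast
  obtain l where l: "l \<in> Q" "x = vx k l" using xy(1) \<open>X i' \<subseteq> P\<close> by (auto simp: P_def)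
  then have "l < b" by (simp add: Q_def)
  have "y \<in> nb k l"
    using k(1) \<open>l < b\<close> xy(3)[unfolded l(2)]
    by (rule E_vx_cases) (use xy(2) \<open>X i \<inter> B = {}\<close> in \<open>auto simp: B_def\<close>)
  then obtain j c where jc: "j \<in> J k" "c < 3" "c \<noteq> ty l j" "y = h k (j, c)"
    by (auto simp: nb_def)
  have "j < p" using J_subset[OF k(1)] jc(1) by auto
  then have "ty l j = \<sigma> j" using l(1) jc(1) by (simp add: Q_def \<tau>_def)
  then show False using \<sigma>(2)[OF jc(1,2)] jc xy(2) by simp
qed

section \<open>The list assignment\<close>

text \<open>
  Here \<open>3 * p + j\<close> is the fourth colour of the \<open>j\<close>-th class of demand 3; the colours from \<open>4 * p\<close> on are the singleton classes of demand 1.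
\<close>

definition colour_class :: "nat \<Rightarrow> nat set" where
  "colour_class j = insert (3 * p + j) ((\<lambda>i. 3 * j + i) ` {..<3})"

definition copy_list :: "nat \<Rightarrow> nat \<Rightarrow> nat \<Rightarrow> nat set" where
  "copy_list w k l = {4 * p..<4 * p + w}
     \<union> {3 * j + i | j i. j < p \<and> i < 3 \<and> (j \<in> J k \<longrightarrow> i \<noteq> ty l j)} \<union> (\<lambda>j. 3 * p + j) ` J k"

definition colour_list :: "nat \<Rightarrow> nat \<Rightarrow> nat set" where
  "colour_list w v = (if v < b + u then {4 * p..<4 * p + w} \<union> {..<3 * p}
     else copy_list w ((v - (b + u)) div b) ((v - (b + u)) mod b))"

lemma colour_list_vx: "l < b \<Longrightarrow> colour_list w (vx k l) = copy_list w k l"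
  by (simp add: colour_list_def vx_def)

lemma colour_list_cases:
  assumes "v \<in> V"
  obtains "v < b + u" "colour_list w v = {4 * p..<4 * p + w} \<union> {..<3 * p}"
  | k l where "k < K" "l < b" "v = vx k l" "colour_list w v = copy_list w k l"
proof (cases "v < b + u")
  case True
  then show thesis by (intro that(1)) (auto simp: colour_list_def)
next
  case False
  then obtain k l where "k < K" "l < b" "v = vx k l" using assms by (auto simp: V_def)
  then show thesis using that(2) colour_list_vx by blast
qed

lemma three_le_card_copy_list:
  assumes "j < p"
  shows "3 \<le> card (copy_list w k l \<inter> colour_class j)"
proof (cases "j \<in> J k")
  case False
  have "card ((\<lambda>i. 3 * j + i) ` {..<3}) \<le> card (copy_list w k l \<inter> colour_class j)"
    by (rule card_mono) (use False assms in \<open>auto simp: copy_list_def colour_class_def\<close>)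
  then show ?thesis by (simp add: card_image)
next
  case True
  let ?T = "(\<lambda>i. 3 * j + i) ` ({..<3} - {ty l j})"
  have "card (insert (3 * p + j) ?T) \<le> card (copy_list w k l \<inter> colour_class j)"
    by (rule card_mono) (use True assms in \<open>auto simp: copy_list_def colour_class_def\<close>)
  moreover have "3 * p + j \<notin> ?T" using assms by auto
  \<comment> \<open>Only an inequality, as \<open>ty l j\<close> may be 3 or more, and then nothing
    is removed.\<close>
  moreover have "2 \<le> card ?T"
    using diff_card_le_card_Diff[of "{ty l j}" "{..<3}"] by (simp add: card_image)
  ultimately show ?thesis by simp
qed

lemma copy_list_subset:
  assumes "k < K"
  shows "copy_list w k l \<subseteq> {4 * p..<4 * p + w} \<union> (\<Union>j<p. colour_class j)"
  using J_subset[OF assms] by (auto simp: copy_list_def colour_class_def)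

lemma colour_list_subset:
  assumes "v \<in> V"
  shows "colour_list w v \<subseteq> {4 * p..<4 * p + w} \<union> (\<Union>j<p. colour_class j)"
  using assms
proof (cases rule: colour_list_cases[where w = w])
  case 1
  have "c \<in> colour_class (c div 3)" for c
    unfolding colour_class_def by (intro insertI2 image_eqI[of _ _ "c mod 3"]) auto
  moreover have "c div 3 < p" if "c < 3 * p" for c using that by auto
  ultimately show ?thesis using 1 by blast
next
  case (2 k l)
  then show ?thesis using copy_list_subset by simp
qed

lemma three_le_card_colour_list:
  assumes "v \<in> V" "j < p"
  shows "3 \<le> card (colour_list w v \<inter> colour_class j)"
  using assms(1)
proof (cases rule: colour_list_cases[where w = w])
  case 1
  have "3 * j + i \<in> {..<3 * p}" if "i < 3" for i using that assms(2) by simp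
  then have "(\<lambda>i. 3 * j + i) ` {..<3} \<subseteq> colour_list w v \<inter> colour_class j"
    unfolding 1(2) by (auto simp: colour_class_def)
  moreover have "finite (colour_list w v \<inter> colour_class j)" by (simp add: colour_class_def)
  ultimately have "card ((\<lambda>i. 3 * j + i) ` {..<3}) \<le> card (colour_list w v \<inter> colour_class j)"
    by (intro card_mono)
  then show ?thesis by (simp add: card_image)
next
  case (2 k l)
  then show ?thesis using three_le_card_copy_list[OF assms(2)] by simp
qed

lemma colour_class_disjoint:
  assumes "i < p" "j < p" "i \<noteq> j"
  shows "colour_class i \<inter> colour_class j = {}"
proof -
  have "3 * i + c \<noteq> 3 * j + d" if "c < 3" "d < 3" for c d
    using that assms(3) by presburger
  then show ?thesis using assms by (auto simp: colour_class_def)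
qed

lemma lambda_list_assignment_colour_list:
  "lambda_list_assignment V (colour_list w) (replicate w 1 @ replicate p 3)"
proof (rule lambda_list_assignmentI)
  let ?ks = "replicate w 1 @ replicate p (3::nat)"
  let ?C = "\<lambda>i. if i < w then {4 * p + i} else colour_class (i - w)"
  \<comment> \<open>This separates the classes of demand 3 from the singletons, whose colours start
    at \<open>4 * p\<close>.\<close>
  have class_less: "c < 4 * p" if "c \<in> colour_class j" "j < p" for c j
    using that by (auto simp: colour_class_def)
  show "finite (colour_list w v)" if "v \<in> V" for v
    by (rule finite_subset[OF colour_list_subset[OF that]]) (auto simp: colour_class_def)
  show "?C i \<inter> ?C j = {}" if "i < length ?ks" "j < length ?ks" "i \<noteq> j" for i j
  proof -
    have "4 * p + n \<notin> colour_class (m - w)" if "m < length ?ks" "\<not> m < w" for m n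
    proof
      assume "4 * p + n \<in> colour_class (m - w)"
      moreover have "m - w < p" using that by simp
      ultimately have "4 * p + n < 4 * p" by (rule class_less)
      then show False by simp
    qed
    moreover have "colour_class (i - w) \<inter> colour_class (j - w) = {}" if "\<not> i < w" "\<not> j < w"
      by (rule colour_class_disjoint)
        (use that \<open>i < length ?ks\<close> \<open>j < length ?ks\<close> \<open>i \<noteq> j\<close> in auto)
    ultimately show ?thesis using that by simp
  qed
  show "(\<Union>v\<in>V. colour_list w v) \<subseteq> (\<Union>i<length ?ks. ?C i)"
  proof
    fix c assume "c \<in> (\<Union>v\<in>V. colour_list w v)"
    then consider "c \<in> {4 * p..<4 * p + w}" | j where "j < p" "c \<in> colour_class j"
      using colour_list_subset by blast
    then show "c \<in> (\<Union>i<length ?ks. ?C i)"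
    proof cases
      case 1
      then show ?thesis by (intro UN_I[of "c - 4 * p"]) auto
    next
      case 2
      then show ?thesis by (intro UN_I[of "w + j"]) auto
    qed
  qed
  show "?ks ! i \<le> card (colour_list w v \<inter> ?C i)" if v: "v \<in> V" and i: "i < length ?ks" for v i
  proof (cases "i < w")
    case True
    have "4 * p + i \<in> colour_list w v"
      using v by (cases rule: colour_list_cases[where w = w]) (use True in \<open>auto simp: copy_list_def\<close>)
    then show ?thesis using True by (simp add: nth_append)
  next
    case False
    then show ?thesis using three_le_card_colour_list[OF v] i by (simp add: nth_append)
  qed
qed

text \<open>No colour of a triple in \<open>J k\<close> is usable on the copy: each vertex sees two
  of the three on its neighbours and lacks the third in its list. What remains is \<open>R\<close>:
  the \<open>w\<close> singletons, the other \<open>p - u\<close> triples and \<open>u\<close>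
  fourth colours. The copy is a clique, so its \<open>b\<close> colours are distinct.\<close>

lemma copy_size_le:
  assumes f: "L_colouring V E (colour_list w) f" and k: "k < K"
    and h: "\<And>j i. j \<in> J k \<Longrightarrow> i < 3 \<Longrightarrow> f (h k (j, i)) = 3 * j + i"
  shows "b \<le> w + 3 * (p - u) + u"
proof -
  define R where "R = {4 * p..<4 * p + w} \<union> (\<lambda>(j, i). 3 * j + i) ` (({..<p} - J k) \<times> {..<3})
    \<union> (\<lambda>j. 3 * p + j) ` J k"
  have finJ: "finite (J k)" using J_subset[OF k] finite_subset by blast
  have in_R: "f (vx k l) \<in> R" if "l < b" for l
  proof -
    have "vx k l \<in> V" using that k by (auto simp: V_def)
    then have L: "f (vx k l) \<in> copy_list w k l"
      using f that unfolding L_colouring_def by (metis colour_list_vx)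
    show ?thesis
    proof (cases "f (vx k l) < 3 * p")
      case False
      then show ?thesis using L by (auto simp: R_def copy_list_def)
    next
      case True
      then obtain j i where ji: "f (vx k l) = 3 * j + i" "i < 3" "j < p" "j \<in> J k \<longrightarrow> i \<noteq> ty l j"
        using L by (auto simp: copy_list_def)
      have "j \<notin> J k"
      proof
        assume j: "j \<in> J k"
        then have "h k (j, i) \<in> nb k l" using ji by (auto simp: nb_def)
        then have "E (vx k l) (h k (j, i))" using that k by (auto simp: E_def)
        then show False using f h[OF j ji(2)] ji(1) unfolding L_colouring_def by metis
      qed
      then show ?thesis using ji by (force simp: R_def)
    qed
  qed
  have "inj_on (\<lambda>l. f (vx k l)) {..<b}"
  proof (rule inj_onI, rule ccontr)
    fix l l' assume "l \<in> {..<b}" "l' \<in> {..<b}" "f (vx k l) = f (vx k l')" "l \<noteq> l'"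
    moreover from this have "E (vx k l) (vx k l')" unfolding E_def using k by blast
    ultimately show False using f unfolding L_colouring_def by metis
  qed
  moreover have "(\<lambda>l. f (vx k l)) ` {..<b} \<subseteq> R" using in_R by auto
  moreover have "finite R" using finJ by (auto simp: R_def)
  ultimately have "card {..<b} \<le> card R" by (rule card_inj_on_le)
  also have "card R \<le> card {4 * p..<4 * p + w}
      + card ((\<lambda>(j, i). 3 * j + i) ` (({..<p} - J k) \<times> {..<3::nat}))
      + card ((\<lambda>j. 3 * p + j) ` J k)"
    unfolding R_def by (meson add_le_mono card_Un_le le_refl order_trans)
  also have "\<dots> \<le> w + card (({..<p} - J k) \<times> {..<3::nat}) + card (J k)"
    using finJ by (intro add_mono card_image_le) auto
  also have "card (({..<p} - J k) \<times> {..<3::nat}) = 3 * (p - u)"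
    using J_subset[OF k] card_J[OF k] finJ by (simp add: card_cartesian_product card_Diff_subset)
  finally show ?thesis using card_J[OF k] by simp
qed

end

section \<open>Colourings of the central clique and the choice of copies\<close>

lemma card_full_triples_ge:
  assumes fin: "finite W" and sub: "{..<3 * p} \<subseteq> W" "F \<subseteq> W"
  shows "p \<le> card {j. j < p \<and> (\<forall>i<3. 3 * j + i \<in> F)} + (card W - card F)"
proof -
  let ?full = "{j. j < p \<and> (\<forall>i<3. 3 * j + i \<in> F)}"
  let ?rest = "{j. j < p \<and> (\<exists>i<3. 3 * j + i \<notin> F)}"
  \<comment> \<open>Each incomplete triple has a colour in \<open>W - F\<close>. Triples are
    disjoint, so these colours differ and there are at most \<open>card W - card F\<close>
    incomplete triples.\<close>
  have "\<forall>j\<in>?rest. \<exists>i<3. 3 * j + i \<notin> F" by blast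
  then have "\<exists>g. \<forall>j\<in>?rest. g j < 3 \<and> 3 * j + g j \<notin> F" by (rule bchoice)
  then obtain g where "\<forall>j\<in>?rest. g j < 3 \<and> 3 * j + g j \<notin> F" by (elim exE)
  then have g: "g j < 3 \<and> 3 * j + g j \<notin> F" if "j \<in> ?rest" for j using that by (rule bspec)
  have "inj_on (\<lambda>j. 3 * j + g j) ?rest"
  proof (rule inj_onI)
    fix j j' assume "j \<in> ?rest" "j' \<in> ?rest" "3 * j + g j = 3 * j' + g j'"
    then show "j = j'" using g[of j] g[of j'] by linarith
  qed
  moreover have "(\<lambda>j. 3 * j + g j) ` ?rest \<subseteq> W - F"
  proof
    fix c assume "c \<in> (\<lambda>j. 3 * j + g j) ` ?rest"
    then obtain j where j: "j \<in> ?rest" "c = 3 * j + g j" by blast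
    then have "c < 3 * p" using g[OF j(1)] by auto
    then show "c \<in> W - F" using g[OF j(1)] j(2) sub by auto
  qed
  ultimately have "card ?rest \<le> card (W - F)" using fin by (intro card_inj_on_le) auto
  also have "\<dots> = card W - card F"
    using sub(2) fin by (intro card_Diff_subset) (auto intro: finite_subset)
  finally have "card ?rest \<le> card W - card F" .
  moreover have "card (?full \<union> ?rest) \<le> card ?full + card ?rest" by (rule card_Un_le)
  moreover have "?full \<union> ?rest = {..<p}" by auto
  ultimately show ?thesis by simp
qed

theorem theorem3:
  fixes a :: nat
  shows "\<exists>t2::nat. \<forall>t\<ge>t2. \<exists>V E. graph V E \<and> \<not> has_K_minor V E t \<and>
           \<not> lambda_choosable V E (replicate (t - 5*a - 9) 1 @ replicate (2*a + 3) 3)"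
\<comment> \<open>The first summand is \<open>2 * u\<close> for each of the \<open>3 ^ p\<close>
  types; \<open>5 * a + 9\<close> keeps the truncated subtractions exact.\<close>
proof (intro exI[of _ "2 * (a + 2) * 3 ^ (2 * a + 3) + 5 * a + 9"] allI impI)
  fix t :: nat assume t: "2 * (a + 2) * 3 ^ (2 * a + 3) + 5 * a + 9 \<le> t"
  define u p b w where "u = a + 2" and "p = 2 * a + 3" and "b = t - a - 3" and "w = t - 5 * a - 9"
  have bu: "b + u + 1 = t" using t by (simp add: b_def u_def)
  let ?types = "{..<p} \<rightarrow>\<^sub>E {..<3::nat}"
  have "\<exists>f :: nat \<Rightarrow> nat \<Rightarrow> nat. \<forall>\<tau>\<in>?types. 2 * u \<le> card {l\<in>{..<b}. f l = \<tau>}"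
  proof (rule ex_labelling_large_fibres)
    show "finite ?types" by (intro finite_PiE) auto
    have "(\<lambda>_\<in>{..<p}. 0) \<in> ?types" by auto
    then show "?types \<noteq> {}" by blast
    show "2 * u * card ?types \<le> b" using t by (simp add: card_PiE u_def p_def b_def)
  qed
  then obtain ty :: "nat \<Rightarrow> nat \<Rightarrow> nat"
    where ty: "\<forall>\<tau>\<in>?types. 2 * u \<le> card {l\<in>{..<b}. ty l = \<tau>}" by (elim exE)
  \<comment> \<open>One copy for each possible placement of \<open>u\<close> triples in
    \<open>A\<close>; extensionality of \<open>h\<close> keeps the number of copies finite.\<close>
  define D where "D = {(J, h). J \<subseteq> {..<p} \<and> card J = u \<and> h \<in> J \<times> {..<3::nat} \<rightarrow>\<^sub>E {..<b + u}}"
  have "D \<subseteq> (SIGMA J:Pow {..<p}. J \<times> {..<3::nat} \<rightarrow>\<^sub>E {..<b + u})" by (auto simp: D_def)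
  moreover have "finite (SIGMA J:Pow {..<p}. J \<times> {..<3::nat} \<rightarrow>\<^sub>E {..<b + u})"
    by (intro finite_SigmaI finite_PiE) (auto intro: finite_subset)
  ultimately have "finite D" by (rule finite_subset)
  then obtain e where e: "bij_betw e {0..<card D} D" using ex_bij_betw_nat_finite by blast
  have eD: "e k \<in> D" if "k < card D" for k using e that by (auto simp: bij_betw_def)
  interpret triple_gluing b "card D" u p "\<lambda>k. fst (e k)" "\<lambda>k. snd (e k)" ty
  proof
    fix k assume "k < card D"
    then have "e k \<in> D" by (rule eD)
    then show "fst (e k) \<subseteq> {..<p}" "card (fst (e k)) = u"
        "snd (e k) ` (fst (e k) \<times> {..<3}) \<subseteq> {..<b + u}"
      by (auto simp: D_def dest!: PiE_mem)
  next
    fix \<tau> assume "\<tau> \<in> ?types"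
    then have "2 * u \<le> card {l\<in>{..<b}. ty l = \<tau>}" using ty by blast
    also have "\<dots> \<le> card {l\<in>{..<b}. \<forall>j<p. ty l j = \<tau> j}" by (intro card_mono) auto
    finally show "2 * u \<le> card {l\<in>{..<b}. \<forall>j<p. ty l j = \<tau> j}" .
  qed
  have "\<not> L_colouring V E (colour_list w) f" for f
  proof
    assume f: "L_colouring V E (colour_list w) f"
    let ?A = "{..<b + u}" and ?W = "{4 * p..<4 * p + w} \<union> {..<3 * p}"
    have inj: "inj_on f ?A"
    proof (rule inj_onI, rule ccontr)
      fix x y assume "x \<in> ?A" "y \<in> ?A" "f x = f y" "x \<noteq> y"
      moreover from this have "E x y" by (simp add: E_def)
      ultimately show False using f by (simp add: L_colouring_def)
    qed
    have "f v \<in> ?W" if "v \<in> ?A" for v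
    proof -
      have "v \<in> V" using that by (simp add: V_def)
      then have "f v \<in> colour_list w v" using f by (simp add: L_colouring_def)
      then show ?thesis using that by (simp add: colour_list_def)
    qed
    then have "f ` ?A \<subseteq> ?W" by blast
    then have "p \<le> card {j. j < p \<and> (\<forall>i<3. 3 * j + i \<in> f ` ?A)} + (card ?W - card (f ` ?A))"
      by (intro card_full_triples_ge) auto
    moreover have "card ?W = 3 * p + w" by (subst card_Un_disjoint) auto
    moreover have "card (f ` ?A) = b + u" using inj by (simp add: card_image)
    \<comment> \<open>Here \<open>card ?W = t + a\<close> and \<open>b + u = t - 1\<close>, so
      \<open>a + 1\<close> colours are missed and \<open>p - (a + 1) = u\<close>.\<close>
    ultimately have "u \<le> card {j. j < p \<and> (\<forall>i<3. 3 * j + i \<in> f ` ?A)}"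
      using t by (simp add: u_def p_def b_def w_def)
    then obtain J where J: "J \<subseteq> {j. j < p \<and> (\<forall>i<3. 3 * j + i \<in> f ` ?A)}" "card J = u"
      by (rule obtain_subset_with_card_n)
    \<comment> \<open>\<open>h\<close> locates the vertices of \<open>A\<close> bearing the colours
      of the chosen triples, which singles out the copy that defeats \<open>f\<close>.\<close>
    define h where "h = (\<lambda>(j, i)\<in>J \<times> {..<3}. inv_into ?A f (3 * j + i))"
    have fh: "3 * j + i \<in> f ` ?A" if "j \<in> J" "i < 3" for j i using J(1) that by blast
    have "(J, h) \<in> D"
      using J fh by (auto simp: D_def h_def intro!: inv_into_into)
    then have "(J, h) \<in> e ` {0..<card D}" using e by (simp add: bij_betw_def)
    then obtain k where k: "k < card D" "e k = (J, h)" by auto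
    have "b \<le> w + 3 * (p - u) + u"
    proof (rule copy_size_le[OF f k(1)])
      fix j i :: nat assume "j \<in> fst (e k)" "i < 3"
      then show "f (snd (e k) (j, i)) = 3 * j + i"
        using f_inv_into_f[OF fh] by (simp add: k(2) h_def)
    qed
    \<comment> \<open>The bound evaluates to \<open>t - a - 4 = b - 1\<close>.\<close>
    then show False using t by (simp add: u_def p_def b_def w_def)
  qed
  then have "\<not> lambda_choosable V E (replicate w 1 @ replicate p 3)"
    using lambda_list_assignment_colour_list[of w] unfolding lambda_choosable_def by blast
  then show "\<exists>V E. graph V E \<and> \<not> has_K_minor V E t \<and>
           \<not> lambda_choosable V E (replicate (t - 5*a - 9) 1 @ replicate (2*a + 3) 3)"
    using graph_V_E no_K_minor[unfolded bu] unfolding w_def p_def by (intro exI conjI)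
qed

end
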